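(* Let $V$ be a real vector space, and let $(j,F)$ be a free vector lattice over $V$. Then $F$ is Archimedean. Take a linear subspace $L^\sharp$ of the vector space $V^\sharp$ of all linear functionals on $V$ and, for $l^\sharp\in L^\sharp$, let $\overline{l^\sharp}:F\to\mathbb{R}$ be the unique vector lattice homomorphism such that $\overline{l^\sharp}\circ j=l^\sharp$. If $L^\sharp$ separates the points of $V$, then the linear subspace $\{\overline{l^\sharp}: l^\sharp\in L^\sharp\}$ of the vector space $F^\sharp$ of all linear functionals on $F$ separates the points of $F$.
   Context: All vector spaces and vector lattices are over $\mathbb{R}$; vector lattices are not assumed to be Archimedean. A free vector lattice over a real vector space $V$ is a pair $(j,F)$, where $F$ is a vector lattice and $j:V\to F$ is a linear map, such that for every vector lattice $G$ and every linear map $\varphi:V\to G$ there exists a unique vector lattice homomorphism $\overline{\varphi}:F\to G$ with $\overline{\varphi}\circ j=\varphi$. A set $M$ of linear functionals on a vector space $W$ separates the points of $W$ if for every $w\in W$ with $w\neq 0$ there is $m\in M$ with $m(w)\neq 0$.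
   Formalization: The set of extensions of functionals in L♯ is not in general a linear subspace of F♯ (it fails for V = L♯ = ℝ, F = ℝ²), so the formal statement says only that it is a set of linear functionals on F that separates the points of F. *)

theory Defs
  imports Complex_Main "HOL-Library.Equipollence"
begin

class vector_lattice = ordered_real_vector + lattice

instance real :: vector_lattice ..

definition vector_lattice_hom :: "('a::vector_lattice \<Rightarrow> 'b::vector_lattice) \<Rightarrow> bool" where
  "vector_lattice_hom h \<longleftrightarrow>
     linear h \<and> (\<forall>x y. h (sup x y) = sup (h x) (h y)) \<and> (\<forall>x y. h (inf x y) = inf (h x) (h y))"

definition archimedean_vector_lattice :: "'a::vector_lattice itself \<Rightarrow> bool" where
  "archimedean_vector_lattice _ \<longleftrightarrow>
     (\<forall>x y :: 'a. (\<forall>n::nat. n \<ge> 1 \<longrightarrow> real n *\<^sub>R x \<le> y) \<longrightarrow> x \<le> 0)"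


text \<open>
  The universal property of a free vector lattice quantifies over all vector lattices inside a
  hypothesis, which type classes cannot express. The test objects are therefore vector lattices
  whose carrier is an arbitrary subset of a type \<open>'u\<close>.
\<close>

record 'u vl =
  vl_carrier :: "'u set"
  vl_zero :: 'u
  vl_add :: "'u \<Rightarrow> 'u \<Rightarrow> 'u"
  vl_scale :: "real \<Rightarrow> 'u \<Rightarrow> 'u"
  vl_le :: "'u \<Rightarrow> 'u \<Rightarrow> bool"
  vl_sup :: "'u \<Rightarrow> 'u \<Rightarrow> 'u"
  vl_inf :: "'u \<Rightarrow> 'u \<Rightarrow> 'u"

locale vector_lattice_on =
  fixes G :: "'u vl"
  assumes zero_closed: "vl_zero G \<in> vl_carrier G"
    and add_closed: "\<lbrakk>x \<in> vl_carrier G; y \<in> vl_carrier G\<rbrakk> \<Longrightarrow> vl_add G x y \<in> vl_carrier G"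
    and scale_closed: "x \<in> vl_carrier G \<Longrightarrow> vl_scale G a x \<in> vl_carrier G"
    and add_assoc: "\<lbrakk>x \<in> vl_carrier G; y \<in> vl_carrier G; z \<in> vl_carrier G\<rbrakk>
      \<Longrightarrow> vl_add G (vl_add G x y) z = vl_add G x (vl_add G y z)"
    and add_commute: "\<lbrakk>x \<in> vl_carrier G; y \<in> vl_carrier G\<rbrakk> \<Longrightarrow> vl_add G x y = vl_add G y x"
    and add_zero: "x \<in> vl_carrier G \<Longrightarrow> vl_add G x (vl_zero G) = x"
    and add_inverse: "x \<in> vl_carrier G \<Longrightarrow> \<exists>y\<in>vl_carrier G. vl_add G x y = vl_zero G"
    and scale_add_right: "\<lbrakk>x \<in> vl_carrier G; y \<in> vl_carrier G\<rbrakk>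
      \<Longrightarrow> vl_scale G a (vl_add G x y) = vl_add G (vl_scale G a x) (vl_scale G a y)"
    and scale_add_left: "x \<in> vl_carrier G
      \<Longrightarrow> vl_scale G (a + b) x = vl_add G (vl_scale G a x) (vl_scale G b x)"
    and scale_scale: "x \<in> vl_carrier G \<Longrightarrow> vl_scale G a (vl_scale G b x) = vl_scale G (a * b) x"
    and scale_one: "x \<in> vl_carrier G \<Longrightarrow> vl_scale G 1 x = x"
    and le_refl: "x \<in> vl_carrier G \<Longrightarrow> vl_le G x x"
    and le_antisym: "\<lbrakk>x \<in> vl_carrier G; y \<in> vl_carrier G; vl_le G x y; vl_le G y x\<rbrakk> \<Longrightarrow> x = y"
    and le_trans: "\<lbrakk>x \<in> vl_carrier G; y \<in> vl_carrier G; z \<in> vl_carrier G;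
      vl_le G x y; vl_le G y z\<rbrakk> \<Longrightarrow> vl_le G x z"
    and add_mono: "\<lbrakk>x \<in> vl_carrier G; y \<in> vl_carrier G; z \<in> vl_carrier G; vl_le G x y\<rbrakk>
      \<Longrightarrow> vl_le G (vl_add G x z) (vl_add G y z)"
    and scale_mono: "\<lbrakk>x \<in> vl_carrier G; y \<in> vl_carrier G; 0 \<le> a; vl_le G x y\<rbrakk>
      \<Longrightarrow> vl_le G (vl_scale G a x) (vl_scale G a y)"
    and sup_closed: "\<lbrakk>x \<in> vl_carrier G; y \<in> vl_carrier G\<rbrakk> \<Longrightarrow> vl_sup G x y \<in> vl_carrier G"
    and sup_ge1: "\<lbrakk>x \<in> vl_carrier G; y \<in> vl_carrier G\<rbrakk> \<Longrightarrow> vl_le G x (vl_sup G x y)"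
    and sup_ge2: "\<lbrakk>x \<in> vl_carrier G; y \<in> vl_carrier G\<rbrakk> \<Longrightarrow> vl_le G y (vl_sup G x y)"
    and sup_least: "\<lbrakk>x \<in> vl_carrier G; y \<in> vl_carrier G; z \<in> vl_carrier G;
      vl_le G x z; vl_le G y z\<rbrakk> \<Longrightarrow> vl_le G (vl_sup G x y) z"
    and inf_closed: "\<lbrakk>x \<in> vl_carrier G; y \<in> vl_carrier G\<rbrakk> \<Longrightarrow> vl_inf G x y \<in> vl_carrier G"
    and inf_le1: "\<lbrakk>x \<in> vl_carrier G; y \<in> vl_carrier G\<rbrakk> \<Longrightarrow> vl_le G (vl_inf G x y) x"
    and inf_le2: "\<lbrakk>x \<in> vl_carrier G; y \<in> vl_carrier G\<rbrakk> \<Longrightarrow> vl_le G (vl_inf G x y) y"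
    and inf_greatest: "\<lbrakk>x \<in> vl_carrier G; y \<in> vl_carrier G; z \<in> vl_carrier G;
      vl_le G z x; vl_le G z y\<rbrakk> \<Longrightarrow> vl_le G z (vl_inf G x y)"

definition linear_into :: "'u vl \<Rightarrow> ('a::real_vector \<Rightarrow> 'u) \<Rightarrow> bool" where
  "linear_into G h \<longleftrightarrow>
     (\<forall>x. h x \<in> vl_carrier G) \<and>
     (\<forall>x y. h (x + y) = vl_add G (h x) (h y)) \<and>
     (\<forall>a x. h (a *\<^sub>R x) = vl_scale G a (h x))"

definition vector_lattice_hom_into :: "'u vl \<Rightarrow> ('a::vector_lattice \<Rightarrow> 'u) \<Rightarrow> bool" where
  "vector_lattice_hom_into G h \<longleftrightarrow>
     linear_into G h \<and>
     (\<forall>x y. h (sup x y) = vl_sup G (h x) (h y)) \<and>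
     (\<forall>x y. h (inf x y) = vl_inf G (h x) (h y))"

text \<open>The class-based and the carrier-based notions agree.\<close>

definition vl_of_class :: "'a::vector_lattice vl" where
  "vl_of_class = \<lparr>vl_carrier = UNIV, vl_zero = 0, vl_add = (+), vl_scale = (*\<^sub>R),
     vl_le = (\<le>), vl_sup = sup, vl_inf = inf\<rparr>"

lemma vector_lattice_on_vl_of_class: "vector_lattice_on (vl_of_class :: 'a::vector_lattice vl)"
  by unfold_locales
    (auto simp: vl_of_class_def algebra_simps scaleR_left_mono intro: exI[of _ "- x" for x])

lemma linear_into_vl_of_class: "linear_into vl_of_class h \<longleftrightarrow> linear h"
  by (auto simp: linear_into_def vl_of_class_def linear_iff)

lemma vector_lattice_hom_into_vl_of_class:
  "vector_lattice_hom_into vl_of_class h \<longleftrightarrow> vector_lattice_hom h"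
  unfolding vector_lattice_hom_into_def vector_lattice_hom_def linear_into_vl_of_class
  by (simp add: vl_of_class_def)


text \<open>
  \<open>(j, 'f)\<close> is a free vector lattice over \<open>'v\<close>, the vector lattices of the universal property being
  those carried by subsets of \<open>'u\<close>. The type \<open>'u\<close> plays the role of a universe: as soon as it has
  room for a copy of \<open>\<real>\<close> and a copy of \<open>'f\<close>, the universal property for all such vector
  lattices entails the one for vector lattices of arbitrary size.
\<close>

definition free_vector_lattice ::
    "'u itself \<Rightarrow> ('v::real_vector \<Rightarrow> 'f::vector_lattice) \<Rightarrow> bool" where
  "free_vector_lattice _ j \<longleftrightarrow>
     linear j \<and>
     (\<forall>(G :: 'u vl) \<phi>. vector_lattice_on G \<and> linear_into G \<phi> \<longrightarrow>
        (\<exists>!h :: 'f \<Rightarrow> 'u. vector_lattice_hom_into G h \<and> h \<circ> j = \<phi>))"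

definition algebraic_dual :: "('a::real_vector \<Rightarrow> real) set" where
  "algebraic_dual = {f. linear f}"

text \<open>Functions carry no \<open>real_vector\<close> instance, so the library's \<open>subspace\<close> does not apply here.\<close>

definition dual_subspace :: "('a::real_vector \<Rightarrow> real) set \<Rightarrow> bool" where
  "dual_subspace L \<longleftrightarrow>
     L \<subseteq> algebraic_dual \<and>
     (\<lambda>_. 0) \<in> L \<and>
     (\<forall>f\<in>L. \<forall>g\<in>L. (\<lambda>x. f x + g x) \<in> L) \<and>
     (\<forall>c. \<forall>f\<in>L. (\<lambda>x. c * f x) \<in> L)"

definition separates_points :: "('a::real_vector \<Rightarrow> real) set \<Rightarrow> bool" where
  "separates_points M \<longleftrightarrow> (\<forall>w. w \<noteq> 0 \<longrightarrow> (\<exists>m\<in>M. m w \<noteq> 0))"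

definition hom_extension ::
    "('v::real_vector \<Rightarrow> 'f::vector_lattice) \<Rightarrow> ('v \<Rightarrow> real) \<Rightarrow> 'f \<Rightarrow> real" where
  "hom_extension j l = (THE h. vector_lattice_hom h \<and> h \<circ> j = l)"

end

theory Submission
  imports Defs "HOL-Library.Lattice_Algebras" "HOL-Analysis.Convex"
begin

text \<open>
  Uniqueness in the universal property forces \<open>F\<close> to coincide with the sublattice generated by
  \<open>j(V)\<close>, so every element of \<open>F\<close> is a finite supremum of finite infima of elements of \<open>j(V)\<close>.
  Suppose an infimum of \<open>j v\<^sub>1, \<dots>, j v\<^sub>n\<close> is mapped to a number \<open>\<le> 0\<close> by the extension of each
  \<open>l\<close> in a separating space \<open>L\<close>. Then no \<open>l \<in> L\<close> is strictly positive on all \<open>v\<^sub>i\<close>, so by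
  Gordan's theorem of the alternative \<open>0\<close> is a convex combination of the \<open>v\<^sub>i\<close>, and the infimum is
  below the same convex combination of the \<open>j v\<^sub>i\<close>, which is \<open>0\<close>. Hence the extensions of the
  elements of \<open>L\<close> detect the order of \<open>F\<close>: an element that all of them send to \<open>\<le> 0\<close> is
  \<open>\<le> 0\<close>. Applied to \<open>x\<close> and \<open>-x\<close> this gives separation; applied to all of \<open>V\<^sup>\<sharp>\<close> it reduces the
  Archimedean property of \<open>F\<close> to that of \<open>\<real>\<close>.
\<close>

section \<open>Vector lattices\<close>

instance vector_lattice \<subseteq> lattice_ab_group_add ..

text \<open>By \<open>x + c = sup x c + inf x c\<close>, both \<open>a\<close> and \<open>b\<close>
  lie below \<open>?u + ?s - c\<close>, which does not depend on \<open>x\<close>. So does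
  \<open>sup a b\<close>, and the same identity for \<open>sup a b\<close> cancels
  \<open>?s\<close>.\<close>

lemma inf_sup_distrib_lattice_group:
  fixes a b c :: "'a::lattice_ab_group_add"
  shows "inf (sup a b) c = sup (inf a c) (inf b c)"
proof (rule antisym)
  let ?u = "sup (inf a c) (inf b c)"
  let ?s = "sup (sup a b) c"
  have *: "x \<le> ?u + ?s - c" if "inf x c \<le> ?u" "sup x c \<le> ?s" for x
  proof -
    have "x + c = sup x c + inf x c"
      by (rule add_eq_inf_sup)
    also have "\<dots> \<le> ?s + ?u"
      using that by (intro add_mono)
    finally show ?thesis
      by (simp add: algebra_simps)
  qed
  have "sup a b \<le> ?u + ?s - c"
    by (intro sup_least *) (auto intro: le_supI1 le_supI2)
  moreover have "inf (sup a b) c = sup a b + c - ?s"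
    by (simp only: add_eq_inf_sup[of "sup a b" c] add_diff_cancel_left')
  ultimately show "inf (sup a b) c \<le> ?u"
    by (simp only: le_diff_eq diff_le_eq)
qed (auto intro: le_infI1 le_infI2)

lemma scaleR_inf_distrib:
  fixes x y :: "'a::vector_lattice"
  assumes "0 \<le> a"
  shows "a *\<^sub>R inf x y = inf (a *\<^sub>R x) (a *\<^sub>R y)"
proof (cases "a = 0")
  case False
  with assms have "0 < a" by simp
  then have "inf (a *\<^sub>R x) (a *\<^sub>R y) /\<^sub>R a \<le> inf x y"
    by (intro inf_greatest) (simp_all add: pos_divideR_le_eq)
  then have "inf (a *\<^sub>R x) (a *\<^sub>R y) \<le> a *\<^sub>R inf x y"
    using \<open>0 < a\<close> by (simp only: pos_divideR_le_eq)
  moreover have "a *\<^sub>R inf x y \<le> inf (a *\<^sub>R x) (a *\<^sub>R y)"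
    using assms by (intro inf_greatest scaleR_left_mono) auto
  ultimately show ?thesis by (rule antisym[rotated])
qed simp

lemma scaleR_sup_distrib:
  fixes x y :: "'a::vector_lattice"
  assumes "0 \<le> a"
  shows "a *\<^sub>R sup x y = sup (a *\<^sub>R x) (a *\<^sub>R y)"
  using scaleR_inf_distrib[OF assms, of "- x" "- y"]
  by (simp flip: neg_sup_eq_inf)

lemma convex_atLeast_ordered: "convex {x::'a::ordered_real_vector..}"
proof (rule convexI)
  fix y z and u v :: real
  assume yz: "y \<in> {x..}" "z \<in> {x..}" and uv: "0 \<le> u" "0 \<le> v" "u + v = 1"
  have "x = u *\<^sub>R x + v *\<^sub>R x"
    using uv by (simp flip: scaleR_add_left)
  also have "\<dots> \<le> u *\<^sub>R y + v *\<^sub>R z"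
    using yz uv by (intro add_mono scaleR_left_mono) auto
  finally show "u *\<^sub>R y + v *\<^sub>R z \<in> {x..}" by simp
qed

section \<open>The sublattice generated by a linear subspace\<close>

definition vector_sublattice :: "'a::vector_lattice set \<Rightarrow> bool" where
  "vector_sublattice S \<longleftrightarrow>
     subspace S \<and> (\<forall>x\<in>S. \<forall>y\<in>S. sup x y \<in> S \<and> inf x y \<in> S)"

lemma vector_sublattice_UNIV: "vector_sublattice UNIV"
  by (simp add: vector_sublattice_def)

inductive_set inf_closure :: "'a::semilattice_inf set \<Rightarrow> 'a set" for A where
  base: "x \<in> A \<Longrightarrow> x \<in> inf_closure A"
| inf: "x \<in> inf_closure A \<Longrightarrow> y \<in> inf_closure A \<Longrightarrow> inf x y \<in> inf_closure A"

inductive_set sup_closure :: "'a::semilattice_sup set \<Rightarrow> 'a set" for A where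
  base: "x \<in> A \<Longrightarrow> x \<in> sup_closure A"
| sup: "x \<in> sup_closure A \<Longrightarrow> y \<in> sup_closure A \<Longrightarrow> sup x y \<in> sup_closure A"

lemma inf_closure_add:
  fixes A :: "'a::lattice_ab_group_add set"
  assumes A: "\<And>x y. x \<in> A \<Longrightarrow> y \<in> A \<Longrightarrow> x + y \<in> A"
    and x: "x \<in> inf_closure A" and y: "y \<in> inf_closure A"
  shows "x + y \<in> inf_closure A"
  using x
proof induction
  case (base x)
  from y show ?case
    by induction (auto simp: add_inf_distrib_left intro: inf_closure.intros A base)
qed (auto simp: add_inf_distrib_right intro: inf_closure.inf)

lemma sup_closure_add:
  fixes A :: "'a::lattice_ab_group_add set"
  assumes A: "\<And>x y. x \<in> A \<Longrightarrow> y \<in> A \<Longrightarrow> x + y \<in> A"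
    and x: "x \<in> sup_closure A" and y: "y \<in> sup_closure A"
  shows "x + y \<in> sup_closure A"
  using x
proof induction
  case (base x)
  from y show ?case
    by induction (auto simp: add_sup_distrib_left intro: sup_closure.intros A base)
qed (auto simp: add_sup_distrib_right intro: sup_closure.sup)

lemma sup_closure_inf:
  fixes A :: "'a::lattice_ab_group_add set"
  assumes A: "\<And>x y. x \<in> A \<Longrightarrow> y \<in> A \<Longrightarrow> inf x y \<in> A"
    and x: "x \<in> sup_closure A" and y: "y \<in> sup_closure A"
  shows "inf x y \<in> sup_closure A"
  using x
proof induction
  case (base x)
  from y show ?case
  proof induction
    case (sup y z)
    then show ?case
      by (simp add: inf_commute[of x] inf_sup_distrib_lattice_group sup_closure.sup)
  qed (auto intro: sup_closure.base A base)
qed (simp add: inf_sup_distrib_lattice_group sup_closure.sup)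

text \<open>Negation turns a supremum of infima into an infimum of suprema; distributivity, through
  \<open>sup_closure_inf\<close>, restores the original shape.\<close>

lemma sup_inf_closure_uminus:
  fixes A :: "'a::lattice_ab_group_add set"
  assumes A: "\<And>x. x \<in> A \<Longrightarrow> - x \<in> A"
    and x: "x \<in> sup_closure (inf_closure A)"
  shows "- x \<in> sup_closure (inf_closure A)"
  using x
proof induction
  case (base x)
  then show ?case
    by induction (auto intro: sup_closure.intros inf_closure.base A)
qed (auto intro: sup_closure_inf inf_closure.inf)

lemma sup_inf_closure_scaleR_nonneg:
  fixes A :: "'a::vector_lattice set"
  assumes A: "\<And>x. x \<in> A \<Longrightarrow> a *\<^sub>R x \<in> A" and "0 \<le> a"
    and x: "x \<in> sup_closure (inf_closure A)"
  shows "a *\<^sub>R x \<in> sup_closure (inf_closure A)"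
  using x
proof induction
  case (base x)
  then have "a *\<^sub>R x \<in> inf_closure A"
    by induction (auto simp: scaleR_inf_distrib \<open>0 \<le> a\<close> intro: inf_closure.intros A)
  then show ?case by (rule sup_closure.base)
qed (auto simp: scaleR_sup_distrib \<open>0 \<le> a\<close> intro: sup_closure.sup)

lemma vector_sublattice_sup_inf_closure:
  fixes A :: "'a::vector_lattice set"
  assumes "subspace A"
  shows "vector_sublattice (sup_closure (inf_closure A))"
proof -
  let ?B = "sup_closure (inf_closure A)"
  have scale: "a *\<^sub>R x \<in> ?B" if "x \<in> ?B" for a x
  proof (cases "0 \<le> a")
    case True
    then show ?thesis
      using that assms by (intro sup_inf_closure_scaleR_nonneg) (auto simp: subspace_scale)
  next
    case False
    then have "- ((- a) *\<^sub>R x) \<in> ?B"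
      using that assms
      by (intro sup_inf_closure_uminus sup_inf_closure_scaleR_nonneg)
        (auto simp: subspace_scale subspace_neg)
    then show ?thesis by simp
  qed
  have add: "x + y \<in> ?B" if "x \<in> ?B" "y \<in> ?B" for x y
    using that assms by (intro sup_closure_add inf_closure_add) (auto simp: subspace_add)
  have "0 \<in> ?B"
    using assms by (intro sup_closure.base inf_closure.base) (auto simp: subspace_0)
  then show ?thesis
    unfolding vector_sublattice_def subspace_def
    by (auto intro: scale add sup_closure.sup sup_closure_inf inf_closure.inf)
qed

section \<open>The universal property for sublattices of type-class vector lattices\<close>

text \<open>A copy of \<open>S\<close> inside \<open>'u\<close> along an injection \<open>e\<close>.
  It makes a sublattice of a type-class vector lattice an admissible test object, without giving the
  sublattice a type of its own.\<close>

definition vl_transport :: "('g::vector_lattice \<Rightarrow> 'u) \<Rightarrow> 'g set \<Rightarrow> 'u vl" where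
  "vl_transport e S =
     \<lparr>vl_carrier = e ` S, vl_zero = e 0,
      vl_add = (\<lambda>x y. e (inv e x + inv e y)), vl_scale = (\<lambda>a x. e (a *\<^sub>R inv e x)),
      vl_le = (\<lambda>x y. inv e x \<le> inv e y),
      vl_sup = (\<lambda>x y. e (sup (inv e x) (inv e y))), vl_inf = (\<lambda>x y. e (inf (inv e x) (inv e y)))\<rparr>"

lemma vector_lattice_on_vl_transport:
  assumes e: "inj e" and S: "vector_sublattice S"
  shows "vector_lattice_on (vl_transport e S)"
proof -
  have S': "subspace S" "\<And>x y. x \<in> S \<Longrightarrow> y \<in> S \<Longrightarrow> sup x y \<in> S"
    "\<And>x y. x \<in> S \<Longrightarrow> y \<in> S \<Longrightarrow> inf x y \<in> S"
    using S by (auto simp: vector_sublattice_def)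
  note [simp] = S' subspace_0 subspace_add subspace_scale inv_f_f[OF e]
  show ?thesis
  proof (unfold_locales, goal_cases)
    \<comment> \<open>Existence of additive inverses, the one axiom that needs a witness.\<close>
    case (7 x)
    then obtain y where "y \<in> S" "x = e y" by (auto simp: vl_transport_def)
    then show ?case
      using S' by (intro bexI[of _ "e (- y)"]) (auto simp: vl_transport_def subspace_neg)
  qed (auto simp: vl_transport_def algebra_simps scaleR_left_mono)
qed

lemma linear_into_vl_transport:
  assumes "inj e"
  shows "linear_into (vl_transport e S) (e \<circ> h) \<longleftrightarrow> linear h \<and> range h \<subseteq> S"
  using assms
  by (auto simp: linear_into_def vl_transport_def linear_iff inj_eq inj_image_mem_iff)

lemma vector_lattice_hom_into_vl_transport:
  assumes "inj e"
  shows "vector_lattice_hom_into (vl_transport e S) (e \<circ> h) \<longleftrightarrow>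
    vector_lattice_hom h \<and> range h \<subseteq> S"
  unfolding vector_lattice_hom_into_def vector_lattice_hom_def linear_into_vl_transport[OF assms]
  using assms by (auto simp: vl_transport_def inj_eq)

text \<open>The target is a sublattice \<open>S\<close> and not only a whole type, because the proof
  that \<open>range j\<close> generates \<open>'f\<close> maps into a possibly proper
  sublattice.\<close>

lemma free_vector_lattice_sublattice_extension:
  fixes \<phi> :: "'v::real_vector \<Rightarrow> 'g::vector_lattice" and j :: "'v \<Rightarrow> 'f::vector_lattice"
  assumes free: "free_vector_lattice TYPE('u) j"
    and fits: "(UNIV :: 'g set) \<lesssim> (UNIV :: 'u set)"
    and S: "vector_sublattice S" and \<phi>: "linear \<phi>" "range \<phi> \<subseteq> S"
  shows "\<exists>!h. vector_lattice_hom h \<and> range h \<subseteq> S \<and> h \<circ> j = \<phi>"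
proof -
  obtain e :: "'g \<Rightarrow> 'u" where e: "inj e"
    using fits by (auto simp: lepoll_def)
  let ?G = "vl_transport e S"
  have "\<exists>!k. vector_lattice_hom_into ?G k \<and> k \<circ> j = e \<circ> \<phi>"
    using free vector_lattice_on_vl_transport[OF e S] \<phi>
    by (simp add: free_vector_lattice_def linear_into_vl_transport[OF e])
  then obtain k where k: "vector_lattice_hom_into ?G k" "k \<circ> j = e \<circ> \<phi>"
    and uniq: "\<And>k'. vector_lattice_hom_into ?G k' \<Longrightarrow> k' \<circ> j = e \<circ> \<phi> \<Longrightarrow> k' = k"
    by blast
  \<comment> \<open>On the image of \<open>e\<close> the map \<open>inv e\<close> is a right
    inverse, so \<open>k\<close> factors through \<open>e\<close>.\<close>
  have "\<forall>x. k x \<in> e ` S"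
    using k(1) by (simp add: vector_lattice_hom_into_def linear_into_def vl_transport_def)
  then have "k = e \<circ> (inv e \<circ> k)"
    by (auto simp: fun_eq_iff intro!: f_inv_into_f[symmetric])
  then obtain h where h: "k = e \<circ> h" by blast
  have cancel: "e \<circ> f = e \<circ> g \<longleftrightarrow> f = g" for f g :: "'x \<Rightarrow> 'g"
    using e by (auto simp: fun_eq_iff inj_eq)
  show ?thesis
  proof (intro ex1I conjI)
    show "vector_lattice_hom h" "range h \<subseteq> S"
      using k(1) by (simp_all add: h vector_lattice_hom_into_vl_transport[OF e])
    show "h \<circ> j = \<phi>"
      using k(2) by (simp add: h comp_assoc cancel)
  next
    fix h' assume "vector_lattice_hom h' \<and> range h' \<subseteq> S \<and> h' \<circ> j = \<phi>"
    then have "e \<circ> h' = k"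
      by (intro uniq) (auto simp: vector_lattice_hom_into_vl_transport[OF e] comp_assoc)
    then show "h' = h" by (simp add: h cancel)
  qed
qed

corollary free_vector_lattice_extension:
  fixes \<phi> :: "'v::real_vector \<Rightarrow> 'g::vector_lattice" and j :: "'v \<Rightarrow> 'f::vector_lattice"
  assumes "free_vector_lattice TYPE('u) j" and "(UNIV :: 'g set) \<lesssim> (UNIV :: 'u set)"
    and "linear \<phi>"
  shows "\<exists>!h. vector_lattice_hom h \<and> h \<circ> j = \<phi>"
  using free_vector_lattice_sublattice_extension[OF assms(1,2) vector_sublattice_UNIV assms(3)]
  by simp

text \<open>The extension of \<open>j\<close> with values in the generated sublattice, read as a map
  into \<open>'f\<close>, and the identity both extend \<open>j\<close>. By uniqueness they agree,
  so the sublattice is everything.\<close>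

lemma free_vector_lattice_generated:
  fixes j :: "'v::real_vector \<Rightarrow> 'f::vector_lattice"
  assumes free: "free_vector_lattice TYPE('u) j"
    and fits: "(UNIV :: 'f set) \<lesssim> (UNIV :: 'u set)"
  shows "sup_closure (inf_closure (range j)) = UNIV"
proof -
  let ?B = "sup_closure (inf_closure (range j))"
  have j: "linear j"
    using free by (simp add: free_vector_lattice_def)
  then have "vector_sublattice ?B"
    by (intro vector_sublattice_sup_inf_closure linear_subspace_image subspace_UNIV)
  moreover have "range j \<subseteq> ?B"
    by (auto intro: sup_closure.base inf_closure.base)
  ultimately obtain h where h: "vector_lattice_hom h" "range h \<subseteq> ?B" "h \<circ> j = j"
    using free_vector_lattice_sublattice_extension[OF free fits _ j] by blast
  have "vector_lattice_hom (\<lambda>x::'f. x)" "(\<lambda>x. x) \<circ> j = j"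
    by (auto simp: vector_lattice_hom_def linear_iff)
  then have "h = (\<lambda>x. x)"
    using h(1,3) free_vector_lattice_extension[OF free fits j] by blast
  with h(2) show ?thesis by auto
qed

section \<open>Gordan's theorem of the alternative\<close>

lemma dual_subspace_algebraic_dual: "dual_subspace algebraic_dual"
  by (auto simp: dual_subspace_def algebraic_dual_def linear_iff algebra_simps)

lemma separates_points_algebraic_dual:
  "separates_points (algebraic_dual :: ('v::real_vector \<Rightarrow> real) set)"
  unfolding separates_points_def
proof (intro allI impI)
  fix w :: 'v assume "w \<noteq> 0"
  then have "independent {w}" by simp
  then obtain g :: "'v \<Rightarrow> real" where "linear g" "g w = 1"
    using linear_independent_extend[of "{w}" "\<lambda>_. 1"] by auto
  then show "\<exists>m\<in>algebraic_dual. m w \<noteq> 0"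
    by (auto simp: algebraic_dual_def intro!: bexI[of _ g])
qed

text \<open>
  Fourier--Motzkin elimination: if \<open>l\<close> is positive on the \<open>v i\<close> but not on \<open>w\<close>, move each \<open>v i\<close>
  along the segment towards \<open>w\<close> until \<open>l\<close> vanishes; a functional \<open>l'\<close> that is positive on the new
  points becomes positive on the old ones after adding a suitable multiple of \<open>l\<close>.
\<close>
lemma gordan_alternative:
  fixes v :: "'i \<Rightarrow> 'v::real_vector"
  assumes L: "dual_subspace L" and sep: "separates_points L" and "finite I"
    and "0 \<notin> convex hull (v ` I)"
  shows "\<exists>l\<in>L. \<forall>i\<in>I. 0 < l (v i)"
  using assms(3,4)
proof (induction I arbitrary: v rule: finite_induct)
  case empty
  then show ?case using L by (auto simp: dual_subspace_def)
next
  case (insert k I)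
  have lin: "linear l" if "l \<in> L" for l
    using L that by (auto simp: dual_subspace_def algebraic_dual_def)
  have comb: "(\<lambda>x. l' x + t * l x) \<in> L" if "l \<in> L" "l' \<in> L" for l l' t
    using L that by (simp add: dual_subspace_def)
  let ?H = "convex hull (v ` insert k I)"
  have "0 \<notin> convex hull (v ` I)"
    using insert.prems hull_mono[of "v ` I" "v ` insert k I" convex] by blast
  then obtain l where l: "l \<in> L" "\<And>i. i \<in> I \<Longrightarrow> 0 < l (v i)"
    using insert.IH by blast
  show ?case
  proof (cases "I = {}")
    case True
    then have "v k \<noteq> 0" using insert.prems by auto
    then obtain m where m: "m \<in> L" "m (v k) \<noteq> 0"
      using sep by (auto simp: separates_points_def)
    \<comment> \<open>The factor \<open>m (v k)\<close> corrects the sign: the value at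
      \<open>v k\<close> becomes a nonzero square.\<close>
    have "(\<lambda>x. m (v k) * m x) \<in> L"
      using L m(1) by (simp add: dual_subspace_def)
    then show ?thesis
      using True m(2) by (intro bexI[of _ "\<lambda>x. m (v k) * m x"]) (auto simp: zero_less_mult_iff)
  next
    case False
    show ?thesis
    proof (cases "0 < l (v k)")
      case True
      then show ?thesis using l by blast
    next
      case nonpos: False
      define d where "d i = l (v i) - l (v k)" for i
      have d: "0 < d i" if "i \<in> I" for i
        using l(2)[OF that] nonpos by (simp add: d_def)
      \<comment> \<open>The zero of \<open>l\<close> on the segment from \<open>v i\<close> to
        \<open>v k\<close>; the weights are nonnegative because
        \<open>l (v k) \<le> 0 < l (v i)\<close>.\<close>
      define u where "u i = (l (v i) / d i) *\<^sub>R v k + (- l (v k) / d i) *\<^sub>R v i" for i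
      have "u i \<in> ?H" if "i \<in> I" for i
        unfolding u_def
      proof (rule convexD[OF convex_convex_hull])
        show "l (v i) / d i + - l (v k) / d i = 1"
          using d[OF that] by (simp add: d_def flip: diff_divide_distrib)
      qed (use that d[OF that] l(2)[OF that] nonpos in \<open>auto intro: hull_inc simp: divide_nonpos_pos\<close>)
      then have "convex hull (u ` I) \<subseteq> ?H"
        by (intro hull_minimal) auto
      then obtain l' where l': "l' \<in> L" "\<And>i. i \<in> I \<Longrightarrow> 0 < l' (u i)"
        using insert.IH[of u] insert.prems by blast
      \<comment> \<open>Positivity of \<open>l'\<close> at \<open>u i\<close>, cleared of the
        denominator. If \<open>l (v k) < 0\<close>, it says that the lower bound which
        \<open>v i\<close> imposes on \<open>t\<close> is below the upper bound imposed by
        \<open>v k\<close>.\<close>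
      have less: "l (v k) * l' (v i) < l (v i) * l' (v k)" if "i \<in> I" for i
      proof -
        have "l' (u i) = (l (v i) * l' (v k) - l (v k) * l' (v i)) / d i"
          using lin[OF l'(1)] by (simp add: u_def linear_diff linear_scale diff_divide_distrib)
        then show ?thesis
          using l'(2)[OF that] d[OF that] by (simp add: zero_less_divide_iff)
      qed
      \<comment> \<open>\<open>l' + t * l\<close> is positive at \<open>v i\<close> exactly when
        \<open>t\<close> exceeds \<open>- l' (v i) / l (v i)\<close>; \<open>b\<close> is the
        largest of these bounds. Since it is attained at some \<open>i\<close>, \<open>less\<close>
        applies to it.\<close>
      define b where "b = Max ((\<lambda>i. - l' (v i) / l (v i)) ` I)"
      have b: "- l' (v i) / l (v i) \<le> b" if "i \<in> I" for i
        using that insert.hyps(1) by (simp add: b_def)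
      have "b \<in> (\<lambda>i. - l' (v i) / l (v i)) ` I"
        unfolding b_def using False insert.hyps(1) by (intro Max_in) auto
      then obtain i where i: "i \<in> I" "b = - l' (v i) / l (v i)" by blast
      have "0 < l' (v k) + b * l (v k)"
        using less[OF i(1)] l(2)[OF i(1)] by (simp add: i(2) field_simps)
      \<comment> \<open>Strict positivity at \<open>b\<close> leaves room for some \<open>t\<close>
        above \<open>b\<close>; if \<open>l (v k) = 0\<close>, the value at \<open>v k\<close> does
        not depend on \<open>t\<close>.\<close>
      obtain t where t: "b < t" "0 < l' (v k) + t * l (v k)"
      proof (cases "l (v k) = 0")
        case True
        then show ?thesis
          using that[of "b + 1"] \<open>0 < l' (v k) + b * l (v k)\<close> by simp
      next
        case False
        with nonpos have neg: "l (v k) < 0" by simp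
        with \<open>0 < l' (v k) + b * l (v k)\<close> have "b < l' (v k) / (- l (v k))"
          by (simp add: field_simps)
        then obtain t where "b < t" "t < l' (v k) / (- l (v k))"
          using dense by blast
        with neg that show ?thesis by (simp add: field_simps)
      qed
      have "0 < l' (v i) + t * l (v i)" if "i \<in> I" for i
      proof -
        have "- l' (v i) / l (v i) < t"
          using b[OF that] t(1) by simp
        then show ?thesis
          using l(2)[OF that] by (simp add: field_simps)
      qed
      with t(2) comb[OF l(1) l'(1)] show ?thesis
        by (intro bexI[of _ "\<lambda>x. l' x + t * l x"]) auto
    qed
  qed
qed

section \<open>Extensions of functionals detect the order\<close>

text \<open>\<open>S\<close> collects the generators whose infimum is \<open>x\<close>. As the reals
  are totally ordered, a homomorphism into them attains its value at a finite infimum on one of the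
  terms.\<close>

lemma inf_closure_range_lower_bound:
  fixes j :: "'v \<Rightarrow> 'f::vector_lattice"
  assumes "x \<in> inf_closure (range j)"
  obtains S where "finite S" "\<And>s. s \<in> S \<Longrightarrow> x \<le> j s"
    "\<And>h :: 'f \<Rightarrow> real. vector_lattice_hom h \<Longrightarrow> \<exists>s\<in>S. h x = h (j s)"
proof -
  have "\<exists>S. finite S \<and> (\<forall>s\<in>S. x \<le> j s) \<and>
    (\<forall>h :: 'f \<Rightarrow> real. vector_lattice_hom h \<longrightarrow> (\<exists>s\<in>S. h x = h (j s)))"
    using assms
  proof induction
    case (base x)
    then obtain s where "x = j s" by blast
    then show ?case by (intro exI[of _ "{s}"]) auto
  next
    case (inf x y)
    then obtain S T where S: "finite S" "\<forall>s\<in>S. x \<le> j s"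
        "\<forall>h :: 'f \<Rightarrow> real. vector_lattice_hom h \<longrightarrow> (\<exists>s\<in>S. h x = h (j s))"
      and T: "finite T" "\<forall>s\<in>T. y \<le> j s"
        "\<forall>h :: 'f \<Rightarrow> real. vector_lattice_hom h \<longrightarrow> (\<exists>s\<in>T. h y = h (j s))"
      by blast
    have "\<exists>s\<in>S \<union> T. h (inf x y) = h (j s)" if "vector_lattice_hom h" for h :: "'f \<Rightarrow> real"
    proof -
      have "h (inf x y) = h x \<or> h (inf x y) = h y"
        using that by (auto simp: vector_lattice_hom_def inf_min min_def)
      then show ?thesis using S(3) T(3) that by (metis UnCI)
    qed
    then show ?case
      using S T by (intro exI[of _ "S \<union> T"]) (auto intro: le_infI1 le_infI2)
  qed
  then show ?thesis using that by blast
qed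

lemma hom_extension:
  fixes j :: "'v::real_vector \<Rightarrow> 'f::vector_lattice"
  assumes "free_vector_lattice TYPE('u) j" and "(UNIV :: real set) \<lesssim> (UNIV :: 'u set)"
    and "linear l"
  shows "vector_lattice_hom (hom_extension j l)" and "hom_extension j l (j v) = l v"
  using theI'[OF free_vector_lattice_extension[OF assms]]
  unfolding hom_extension_def[symmetric] by (auto simp: fun_eq_iff)

lemma le_zero_if_hom_extension_le_zero:
  fixes j :: "'v::real_vector \<Rightarrow> 'f::vector_lattice"
  assumes real_fits: "(UNIV :: real set) \<lesssim> (UNIV :: 'u set)"
    and F_fits: "(UNIV :: 'f set) \<lesssim> (UNIV :: 'u set)"
    and free: "free_vector_lattice TYPE('u) j"
    and L: "dual_subspace L" and sep: "separates_points L"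
    and le: "\<And>l. l \<in> L \<Longrightarrow> hom_extension j l x \<le> 0"
  shows "x \<le> 0"
proof -
  have j: "linear j"
    using free by (simp add: free_vector_lattice_def)
  have lin: "linear l" if "l \<in> L" for l
    using L that by (auto simp: dual_subspace_def algebraic_dual_def)
  note ext = hom_extension[OF free real_fits lin]
  have "x \<in> sup_closure (inf_closure (range j))"
    by (simp add: free_vector_lattice_generated[OF free F_fits])
  then show ?thesis
    using le
  proof induction
    case (base x)
    obtain S where S: "finite S" "\<And>s. s \<in> S \<Longrightarrow> x \<le> j s"
      "\<And>h :: 'f \<Rightarrow> real. vector_lattice_hom h \<Longrightarrow> \<exists>s\<in>S. h x = h (j s)"
      using inf_closure_range_lower_bound[OF base.hyps] by blast
    \<comment> \<open>The extension of \<open>l\<close> takes at \<open>x\<close> the value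
      \<open>l s\<close> for some \<open>s\<close> in \<open>S\<close>, and this is at most
      0.\<close>
    have "\<not> (\<exists>l\<in>L. \<forall>s\<in>S. 0 < l s)"
      using base.prems S(3)[OF ext(1)] by (fastforce simp: ext(2))
    then have "0 \<in> convex hull S"
      using gordan_alternative[OF L sep S(1), of "\<lambda>s. s"] by auto
    \<comment> \<open>This convex set contains \<open>S\<close>, hence its hull, hence 0.\<close>
    moreover have "convex (j -` {x..})"
      by (intro convex_linear_vimage j convex_atLeast_ordered)
    ultimately have "x \<le> j 0"
      using S(2) hull_minimal[of S "j -` {x..}" convex] by auto
    then show ?case by (simp add: linear_0[OF j])
  next
    case (sup x y)
    have "hom_extension j l x \<le> 0 \<and> hom_extension j l y \<le> 0" if "l \<in> L" for l
      using sup.prems[OF that] ext(1)[OF that] by (simp add: vector_lattice_hom_def)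
    then show ?case using sup.IH by simp
  qed
qed

theorem corollary2p4:
  fixes j :: "'v::real_vector \<Rightarrow> 'f::vector_lattice"
  assumes real_fits: "(UNIV :: real set) \<lesssim> (UNIV :: 'u set)"
    and F_fits: "(UNIV :: 'f set) \<lesssim> (UNIV :: 'u set)"
    and free: "free_vector_lattice TYPE('u) j"
  shows "archimedean_vector_lattice TYPE('f) \<and>
    (\<forall>L :: ('v \<Rightarrow> real) set. dual_subspace L \<longrightarrow>
       (\<forall>l\<in>L. \<exists>!h :: 'f \<Rightarrow> real. vector_lattice_hom h \<and> h \<circ> j = l) \<and>
       (separates_points L \<longrightarrow>
          hom_extension j ` L \<subseteq> algebraic_dual \<and> separates_points (hom_extension j ` L)))"
proof (intro conjI allI impI ballI)
  show "archimedean_vector_lattice TYPE('f)"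
    unfolding archimedean_vector_lattice_def
  proof (intro allI impI)
    fix x y :: 'f assume *: "\<forall>n::nat. 1 \<le> n \<longrightarrow> real n *\<^sub>R x \<le> y"
    show "x \<le> 0"
    proof (rule le_zero_if_hom_extension_le_zero[OF real_fits F_fits free
          dual_subspace_algebraic_dual separates_points_algebraic_dual])
      fix l :: "'v \<Rightarrow> real" assume "l \<in> algebraic_dual"
      then have hom: "vector_lattice_hom (hom_extension j l)"
        by (intro hom_extension(1)[OF free real_fits]) (simp add: algebraic_dual_def)
      have mono: "hom_extension j l a \<le> hom_extension j l b" if "a \<le> b" for a b
        using hom that by (metis vector_lattice_hom_def le_iff_sup)
      have bound: "real n * hom_extension j l x \<le> hom_extension j l y" if "1 \<le> n" for n
        using mono[OF *[rule_format, OF that]] hom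
        by (simp add: vector_lattice_hom_def linear_scale)
      show "hom_extension j l x \<le> 0"
      proof (rule ccontr)
        assume "\<not> hom_extension j l x \<le> 0"
        then obtain n where "hom_extension j l y < real n * hom_extension j l x"
          using reals_Archimedean3 by (meson not_le)
        \<comment> \<open>The \<open>n\<close> obtained may be 0, whereas \<open>bound\<close> needs
          an index of at least 1.\<close>
        also have "\<dots> \<le> real (Suc n) * hom_extension j l x"
          using \<open>\<not> hom_extension j l x \<le> 0\<close> by (intro mult_right_mono) auto
        finally show False using bound[of "Suc n"] by simp
      qed
    qed
  qed
next
  fix L :: "('v \<Rightarrow> real) set" assume L: "dual_subspace L"
  then have lin: "linear l" if "l \<in> L" for l
    using that by (auto simp: dual_subspace_def algebraic_dual_def)
  show "\<exists>!h :: 'f \<Rightarrow> real. vector_lattice_hom h \<and> h \<circ> j = l" if "l \<in> L" for l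
    using free_vector_lattice_extension[OF free real_fits lin[OF that]] .
  have ext: "linear (hom_extension j l)" if "l \<in> L" for l
    using hom_extension(1)[OF free real_fits lin[OF that]] by (simp add: vector_lattice_hom_def)
  then show "hom_extension j ` L \<subseteq> algebraic_dual"
    by (auto simp: algebraic_dual_def)
  assume sep: "separates_points L"
  show "separates_points (hom_extension j ` L)"
    unfolding separates_points_def
  proof (intro allI impI, rule ccontr)
    fix w :: 'f assume "w \<noteq> 0" and "\<not> (\<exists>m\<in>hom_extension j ` L. m w \<noteq> 0)"
    then have zero: "hom_extension j l w = 0" if "l \<in> L" for l
      using that by blast
    \<comment> \<open>Every extension vanishes at \<open>w\<close> and at \<open>- w\<close>, so
      order detection applies to both.\<close>
    note le_zero = le_zero_if_hom_extension_le_zero[OF real_fits F_fits free L sep]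
    have "w \<le> 0" by (rule le_zero) (simp add: zero)
    moreover have "- w \<le> 0" by (rule le_zero) (simp add: zero linear_neg[OF ext])
    ultimately show False using \<open>w \<noteq> 0\<close> by simp
  qed
qed

end
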